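(* Let $0<\gamma<1$, $T>0$, let $N\ge 2$ be an integer, and put $\tau=T/N$, $\mu=\frac{\tau^{-\gamma}}{\Gamma(2-\gamma)}$, and $G_m=(m+1)^{1-\gamma}-m^{1-\gamma}$ for $m\ge 0$. Given real numbers $f_1,\dots,f_{N-1}$, consider the finite difference scheme for the unknowns $u_1,\dots,u_{N-1}\in\mathbb{R}$, with $u_0=u_N=0$: $$ \mu\left[2G_0u_n-\sum_{k=1,\,k\neq n}^{N-1}\bigl(G_{|n-k|-1}-G_{|n-k|}\bigr)u_k+G_nu_0+G_{N-n-1}u_N\right]+u_n=f_n,\qquad 1\le n\le N-1. $$ Then the scheme is uniquely solvable (for every choice of $f_1,\dots,f_{N-1}$ there is exactly one solution $(u_1,\dots,u_{N-1})$), and its stiffness matrix $A$ is a symmetric Toeplitz matrix.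
   Context: The scheme is the discretization, on the uniform mesh $t_n=n\tau$ with $f_n=f(t_n)$, of the two-sided Caputo fractional ordinary differential equation ${}_0D_t^{\gamma}u(t)+{}_tD_1^{\gamma}u(t)+u(t)=f(t)$ with $u(0)=u(T)=0$. The stiffness matrix $A\in\mathbb{R}^{(N-1)\times(N-1)}$ is the coefficient matrix of the scheme when it is written (using $u_0=u_N=0$) as the linear system $Au=f$ with $u=(u_1,\dots,u_{N-1})^T$ and $f=(f_1,\dots,f_{N-1})^T$. A matrix is Toeplitz if $A_{i,j}=A_{i+1,j+1}$ whenever both entries are defined. $\Gamma$ is the Gamma function. *)

theory Defs
  imports "HOL-Analysis.Gamma_Function" "Jordan_Normal_Form.Matrix"
begin

definition mesh_step :: "real \<Rightarrow> nat \<Rightarrow> real" where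
  "mesh_step T N = T / real N"

definition mu :: "real \<Rightarrow> real \<Rightarrow> nat \<Rightarrow> real" where
  "mu \<gamma> T N = mesh_step T N powr (- \<gamma>) / Gamma (2 - \<gamma>)"

text \<open>For \<open>\<gamma> < 1\<close>, the convention \<open>0 powr a = 0\<close> gives the intended value at \<open>m = 0\<close>.\<close>

definition G :: "real \<Rightarrow> nat \<Rightarrow> real" where
  "G \<gamma> m = (real m + 1) powr (1 - \<gamma>) - real m powr (1 - \<gamma>)"

definition idist :: "nat \<Rightarrow> nat \<Rightarrow> nat" where
  "idist n k = nat \<bar>int n - int k\<bar>"

text \<open>Vectors are indexed from 0, so \<open>(u\<^sub>1, \<dots>, u\<^sub>N\<^sub>-\<^sub>1)\<close> is a vector \<open>u\<close> of dimension \<open>N - 1\<close>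
  whose entry \<open>u $ (n - 1)\<close> is the unknown at the mesh point \<open>t\<^sub>n\<close>. The function below recovers
  the values at \<open>t\<^sub>0, \<dots>, t\<^sub>N\<close>, including the homogeneous boundary values.\<close>

definition mesh_value :: "nat \<Rightarrow> real vec \<Rightarrow> nat \<Rightarrow> real" where
  "mesh_value N u n = (if n = 0 \<or> n = N then 0 else u $ (n - 1))"

definition scheme_lhs :: "real \<Rightarrow> real \<Rightarrow> nat \<Rightarrow> (nat \<Rightarrow> real) \<Rightarrow> nat \<Rightarrow> real" where
  "scheme_lhs \<gamma> T N U n =
     mu \<gamma> T N *
       (2 * G \<gamma> 0 * U n
        - (\<Sum>k\<in>{1..N-1} - {n}. (G \<gamma> (idist n k - 1) - G \<gamma> (idist n k)) * U k)
        + G \<gamma> n * U 0 + G \<gamma> (N - n - 1) * U N)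
     + U n"

definition solves_scheme :: "real \<Rightarrow> real \<Rightarrow> nat \<Rightarrow> real vec \<Rightarrow> real vec \<Rightarrow> bool" where
  "solves_scheme \<gamma> T N f u \<longleftrightarrow>
     (\<forall>n\<in>{1..N-1}. scheme_lhs \<gamma> T N (mesh_value N u) n = f $ (n - 1))"

text \<open>\<open>A\<close> is the coefficient matrix of the scheme: writing the scheme as a linear system in the
  unknowns \<open>u\<close> with right-hand side \<open>f\<close> gives \<open>A u = f\<close>.\<close>

definition is_stiffness_matrix :: "real \<Rightarrow> real \<Rightarrow> nat \<Rightarrow> real mat \<Rightarrow> bool" where
  "is_stiffness_matrix \<gamma> T N A \<longleftrightarrow>
     A \<in> carrier_mat (N - 1) (N - 1) \<and>
     (\<forall>u\<in>carrier_vec (N - 1). \<forall>f\<in>carrier_vec (N - 1).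
        solves_scheme \<gamma> T N f u \<longleftrightarrow> A *\<^sub>v u = f)"

definition toeplitz_mat :: "'a mat \<Rightarrow> bool" where
  "toeplitz_mat A \<longleftrightarrow>
     (\<forall>i j. i + 1 < dim_row A \<longrightarrow> j + 1 < dim_col A \<longrightarrow> A $$ (i, j) = A $$ (i + 1, j + 1))"

definition symmetric_mat :: "'a mat \<Rightarrow> bool" where
  "symmetric_mat A \<longleftrightarrow> transpose_mat A = A"

end

theory Submission
  imports Defs "HOL-Analysis.Convex" "Jordan_Normal_Form.Determinant"
begin

text \<open>The coefficient matrix is strictly diagonally dominant: \<open>G\<close> is nonnegative and, by concavity
  of the power function with exponent \<open>1 - \<gamma>\<close>, decreasing, so the off-diagonal entries of row \<open>n\<close>
  telescope on each side of the diagonal to \<open>\<mu> (G\<^sub>0 - G\<^sub>n\<^sub>-\<^sub>1)\<close> and \<open>\<mu> (G\<^sub>0 - G\<^sub>N\<^sub>-\<^sub>n\<^sub>-\<^sub>1)\<close> in absolute value,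
  whereas the diagonal entry is \<open>2 \<mu> G\<^sub>0 + 1\<close>.\<close>

text \<open>In the row where \<open>\<bar>v $ i\<bar>\<close> is maximal, the remaining terms are
  too small to cancel the diagonal one.\<close>

lemma strictly_diag_dominant_kernel:
  fixes A :: "real mat"
  assumes A: "A \<in> carrier_mat n n"
    and dom: "\<And>i. i < n \<Longrightarrow> (\<Sum>j\<in>{0..<n} - {i}. \<bar>A $$ (i, j)\<bar>) < \<bar>A $$ (i, i)\<bar>"
    and v: "v \<in> carrier_vec n" and Av: "A *\<^sub>v v = 0\<^sub>v n"
  shows "v = 0\<^sub>v n"
proof (rule ccontr)
  assume nz: "v \<noteq> 0\<^sub>v n"
  then obtain k where k: "k < n" "v $ k \<noteq> 0"
    using v by (metis carrier_vecD eq_vecI index_zero_vec)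
  define M where "M = Max ((\<lambda>j. \<bar>v $ j\<bar>) ` {0..<n})"
  have le_M: "\<bar>v $ j\<bar> \<le> M" if "j < n" for j
    unfolding M_def using that by (intro Max_ge) auto
  have "M \<in> (\<lambda>j. \<bar>v $ j\<bar>) ` {0..<n}"
    unfolding M_def using k by (intro Max_in) auto
  then obtain i where i: "i < n" "\<bar>v $ i\<bar> = M" by auto
  have "M > 0" using le_M[OF k(1)] k(2) by linarith
  have "0 = (A *\<^sub>v v) $ i" using Av i by simp
  also have "\<dots> = (\<Sum>j\<in>{0..<n}. A $$ (i, j) * v $ j)"
    using A v i by (simp add: scalar_prod_def)
  also have "\<dots> = A $$ (i, i) * v $ i + (\<Sum>j\<in>{0..<n} - {i}. A $$ (i, j) * v $ j)"
    using i by (simp add: sum.remove)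
  finally have "\<bar>A $$ (i, i)\<bar> * M = \<bar>\<Sum>j\<in>{0..<n} - {i}. A $$ (i, j) * v $ j\<bar>"
    by (metis i(2) abs_minus_cancel abs_mult add_eq_0_iff)
  also have "\<dots> \<le> (\<Sum>j\<in>{0..<n} - {i}. \<bar>A $$ (i, j)\<bar> * \<bar>v $ j\<bar>)"
    by (rule order_trans[OF sum_abs]) (simp add: abs_mult)
  also have "\<dots> \<le> (\<Sum>j\<in>{0..<n} - {i}. \<bar>A $$ (i, j)\<bar> * M)"
    by (intro sum_mono mult_left_mono le_M) auto
  also have "\<dots> < \<bar>A $$ (i, i)\<bar> * M"
    using dom[OF i(1)] \<open>M > 0\<close> by (simp flip: sum_distrib_right)
  finally show False by simp
qed

lemma unique_solution_if_trivial_kernel: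
  fixes A :: "'a :: field mat"
  assumes A: "A \<in> carrier_mat n n"
    and ker: "\<And>v. v \<in> carrier_vec n \<Longrightarrow> A *\<^sub>v v = 0\<^sub>v n \<Longrightarrow> v = 0\<^sub>v n"
    and f: "f \<in> carrier_vec n"
  shows "\<exists>!u. u \<in> carrier_vec n \<and> A *\<^sub>v u = f"
proof -
  have "det A \<noteq> 0" using det_0_iff_vec_prod_zero_field[OF A] ker by blast
  \<comment> \<open>The value \<open>()\<close> fills the otherwise arbitrary last argument of
    \<open>ring_mat\<close>.\<close>
  from det_non_zero_imp_unit[OF A this, of "()"]
  obtain B where B: "B \<in> carrier_mat n n" "B * A = 1\<^sub>m n" "A * B = 1\<^sub>m n"
    by (auto simp: Units_def ring_mat_def)
  show ?thesis
  proof (rule ex1I[of _ "B *\<^sub>v f"])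
    show "B *\<^sub>v f \<in> carrier_vec n \<and> A *\<^sub>v (B *\<^sub>v f) = f"
      using A B f by (simp flip: assoc_mult_mat_vec)
  next
    fix u assume "u \<in> carrier_vec n \<and> A *\<^sub>v u = f"
    with A B show "u = B *\<^sub>v f" by (metis assoc_mult_mat_vec one_mult_mat_vec)
  qed
qed

text \<open>Unit vectors pick out the columns. This turns the characterization of the stiffness
  matrix by its action on vectors into an equality of matrices.\<close>

lemma mat_eq_if_mult_vec_eq:
  fixes A B :: "'a :: semiring_1 mat"
  assumes A: "A \<in> carrier_mat m n" and B: "B \<in> carrier_mat m n"
    and eq: "\<And>v. v \<in> carrier_vec n \<Longrightarrow> A *\<^sub>v v = B *\<^sub>v v"
  shows "A = B"
proof (rule eq_matI)
  fix i j assume ij: "i < dim_row B" "j < dim_col B"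
  have "A $$ (i, j) = (A *\<^sub>v unit_vec n j) $ i"
    using A B ij by (simp add: scalar_prod_def unit_vec_def if_distrib[of "times _"] cong: if_cong)
  also have "\<dots> = (B *\<^sub>v unit_vec n j) $ i" by (simp add: eq)
  also have "\<dots> = B $$ (i, j)"
    using A B ij by (simp add: scalar_prod_def unit_vec_def if_distrib[of "times _"] cong: if_cong)
  finally show "A $$ (i, j) = B $$ (i, j)" .
qed (use A B in auto)

text \<open>Midpoint concavity of the power function: add the tangent line bounds at
  \<open>x\<close>, evaluated at \<open>x - 1\<close> and \<open>x + 1\<close>, where the linear
  terms cancel.\<close>

lemma powr_second_difference_nonpos:
  fixes a x :: real
  assumes a: "0 \<le> a" "a \<le> 1" and x: "1 \<le> x"
  shows "(x - 1) powr a + (x + 1) powr a \<le> 2 * x powr a"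
proof -
  \<comment> \<open>This is the tangent bound for \<open>t powr a\<close> at \<open>x\<close>,
    multiplied by \<open>x powr (1 - a)\<close>: weighted AM-GM. The case \<open>t = 0\<close>,
    reached for \<open>x = 1\<close>, rests on the convention \<open>0 powr a = 0\<close>.\<close>
  have tangent: "t powr a * x powr (1 - a) \<le> a * t + (1 - a) * x" if "0 \<le> t" for t
    using a x that by (cases "t = 0") (auto intro: Youngs_inequality_0)
  have "((x - 1) powr a + (x + 1) powr a) * x powr (1 - a) \<le> 2 * x"
    using tangent[of "x - 1"] tangent[of "x + 1"] x by (simp add: algebra_simps)
  also have "2 * x = 2 * x powr a * x powr (1 - a)"
    using x by (simp flip: powr_add)
  finally show ?thesis using x by simp
qed

lemma G_nonneg:
  assumes "\<gamma> \<le> 1"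
  shows "0 \<le> G \<gamma> m"
  using assms unfolding G_def by (simp add: powr_mono2)

text \<open>The increment of \<open>G\<close> from \<open>m\<close> to \<open>Suc m\<close> is the
  second difference of the power function centred at \<open>m + 1\<close>.\<close>

lemma G_Suc_le:
  assumes "0 \<le> \<gamma>" "\<gamma> \<le> 1"
  shows "G \<gamma> (Suc m) \<le> G \<gamma> m"
  using powr_second_difference_nonpos[of "1 - \<gamma>" "real m + 1"] assms
  by (simp add: G_def algebra_simps)

lemma mu_pos:
  assumes "\<gamma> < 2" "T > 0" "N > 0"
  shows "0 < mu \<gamma> T N"
  using assms by (simp add: mu_def mesh_step_def Gamma_real_pos)

definition stiffness_entry :: "real \<Rightarrow> real \<Rightarrow> nat \<Rightarrow> nat \<Rightarrow> nat \<Rightarrow> real" where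
  "stiffness_entry \<gamma> T N n k =
     (if n = k then 2 * mu \<gamma> T N * G \<gamma> 0 + 1
      else - mu \<gamma> T N * (G \<gamma> (idist n k - 1) - G \<gamma> (idist n k)))"

text \<open>Matrix indices start at 0 and mesh points at 1; passing \<open>i\<close> and
  \<open>j\<close> unshifted is harmless, since \<open>stiffness_entry\<close> depends only on the
  distance of its indices.\<close>

definition stiffness_mat :: "real \<Rightarrow> real \<Rightarrow> nat \<Rightarrow> real mat" where
  "stiffness_mat \<gamma> T N = mat (N - 1) (N - 1) (\<lambda>(i, j). stiffness_entry \<gamma> T N i j)"

lemma stiffness_mat_carrier: "stiffness_mat \<gamma> T N \<in> carrier_mat (N - 1) (N - 1)"
  by (simp add: stiffness_mat_def)

text \<open>Row \<open>i\<close> belongs to the mesh point \<open>Suc i\<close>; the boundary terms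
  of the scheme vanish with \<open>mesh_value\<close> at 0 and \<open>N\<close>.\<close>

lemma stiffness_mat_mult_vec:
  assumes u: "u \<in> carrier_vec (N - 1)" and i: "i < N - 1"
  shows "(stiffness_mat \<gamma> T N *\<^sub>v u) $ i = scheme_lhs \<gamma> T N (mesh_value N u) (Suc i)"
proof -
  let ?g = "\<lambda>j. G \<gamma> (idist i j - 1) - G \<gamma> (idist i j)"
  have "(\<Sum>j\<in>{0..<N-1} - {i}. ?g j * u $ j) = (\<Sum>k\<in>{1..N-1} - {Suc i}.
      (G \<gamma> (idist (Suc i) k - 1) - G \<gamma> (idist (Suc i) k)) * mesh_value N u k)"
    by (rule sum.reindex_bij_witness[of _ "\<lambda>k. k - 1" Suc])
      (auto simp: idist_def mesh_value_def)
  moreover have "(stiffness_mat \<gamma> T N *\<^sub>v u) $ i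
    = (\<Sum>j\<in>{0..<N-1}. stiffness_entry \<gamma> T N i j * u $ j)"
    using u i by (simp add: stiffness_mat_def scalar_prod_def)
  moreover have "\<dots> = stiffness_entry \<gamma> T N i i * u $ i
      + (\<Sum>j\<in>{0..<N-1} - {i}. stiffness_entry \<gamma> T N i j * u $ j)"
    using i by (simp add: sum.remove)
  moreover have "(\<Sum>j\<in>{0..<N-1} - {i}. stiffness_entry \<gamma> T N i j * u $ j)
    = - mu \<gamma> T N * (\<Sum>j\<in>{0..<N-1} - {i}. ?g j * u $ j)"
    unfolding sum_distrib_left by (intro sum.cong) (auto simp: stiffness_entry_def)
  ultimately show ?thesis
    using i by (simp add: scheme_lhs_def stiffness_entry_def mesh_value_def algebra_simps)
qed

lemma is_stiffness_matrix_stiffness_mat: "is_stiffness_matrix \<gamma> T N (stiffness_mat \<gamma> T N)"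
  unfolding is_stiffness_matrix_def
proof (intro conjI ballI)
  fix u f :: "real vec"
  assume u: "u \<in> carrier_vec (N - 1)" and f: "f \<in> carrier_vec (N - 1)"
  have "solves_scheme \<gamma> T N f u \<longleftrightarrow>
      (\<forall>i<N - 1. scheme_lhs \<gamma> T N (mesh_value N u) (Suc i) = f $ i)"
    unfolding solves_scheme_def image_Suc_lessThan[symmetric]
    by (auto simp del: image_Suc_lessThan)
  also have "\<dots> \<longleftrightarrow> (\<forall>i<N - 1. (stiffness_mat \<gamma> T N *\<^sub>v u) $ i = f $ i)"
    using stiffness_mat_mult_vec[OF u] by simp
  also have "\<dots> \<longleftrightarrow> stiffness_mat \<gamma> T N *\<^sub>v u = f"
    using f by (auto simp: vec_eq_iff stiffness_mat_def)
  finally show "solves_scheme \<gamma> T N f u \<longleftrightarrow> stiffness_mat \<gamma> T N *\<^sub>v u = f" .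
qed (rule stiffness_mat_carrier)

text \<open>Reduces every claim about stiffness matrices to the explicit one.\<close>

lemma is_stiffness_matrix_iff: "is_stiffness_matrix \<gamma> T N A \<longleftrightarrow> A = stiffness_mat \<gamma> T N"
proof
  assume A: "is_stiffness_matrix \<gamma> T N A"
  show "A = stiffness_mat \<gamma> T N"
  proof (rule mat_eq_if_mult_vec_eq)
    show carrier: "A \<in> carrier_mat (N - 1) (N - 1)"
      using A by (simp add: is_stiffness_matrix_def)
    fix u :: "real vec" assume u: "u \<in> carrier_vec (N - 1)"
    with carrier have "A *\<^sub>v u \<in> carrier_vec (N - 1)" by simp
    \<comment> \<open>Take \<open>A *\<^sub>v u\<close> as right-hand side: \<open>u\<close> then
      solves the scheme, so the explicit matrix sends \<open>u\<close> to the same vector.\<close>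
    with u A is_stiffness_matrix_stiffness_mat[of \<gamma> T N]
    show "A *\<^sub>v u = stiffness_mat \<gamma> T N *\<^sub>v u"
      unfolding is_stiffness_matrix_def by metis
  qed (rule stiffness_mat_carrier)
qed (simp add: is_stiffness_matrix_stiffness_mat)

text \<open>The distance of two indices is symmetric and invariant under a common shift; the latter
  gives the Toeplitz property below.\<close>

lemma symmetric_stiffness_mat: "symmetric_mat (stiffness_mat \<gamma> T N)"
  unfolding symmetric_mat_def stiffness_mat_def
  by (rule eq_matI) (auto simp: stiffness_entry_def idist_def abs_minus_commute)

lemma toeplitz_stiffness_mat: "toeplitz_mat (stiffness_mat \<gamma> T N)"
  by (auto simp: toeplitz_mat_def stiffness_mat_def stiffness_entry_def idist_def)

lemma stiffness_mat_diag_dominant: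
  assumes \<gamma>: "0 \<le> \<gamma>" "\<gamma> \<le> 1" and "T > 0" and i: "i < N - 1"
  shows "(\<Sum>j\<in>{0..<N-1} - {i}. \<bar>stiffness_mat \<gamma> T N $$ (i, j)\<bar>) < \<bar>stiffness_mat \<gamma> T N $$ (i, i)\<bar>"
proof -
  let ?g = "\<lambda>m. G \<gamma> m - G \<gamma> (Suc m)"
  let ?d = "\<lambda>j. G \<gamma> (idist i j - 1) - G \<gamma> (idist i j)"
  have mu: "0 < mu \<gamma> T N" using assms by (intro mu_pos) auto
  have d: "\<bar>stiffness_mat \<gamma> T N $$ (i, j)\<bar> = mu \<gamma> T N * ?d j" if "j \<in> {0..<N-1} - {i}" for j
  proof -
    \<comment> \<open>Off the diagonal the distance is positive, so the truncated subtraction is a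
      true predecessor.\<close>
    have "idist i j = Suc (idist i j - 1)" using that by (auto simp: idist_def)
    then have "0 \<le> ?d j" using G_Suc_le[OF \<gamma>, of "idist i j - 1"] by simp
    then show ?thesis using that i mu by (auto simp: stiffness_mat_def stiffness_entry_def abs_mult)
  qed
  have "{0..<N-1} - {i} = {0..<i} \<union> {Suc i..<N-1}" using i by auto
  then have "(\<Sum>j\<in>{0..<N-1} - {i}. ?d j) = (\<Sum>j\<in>{0..<i}. ?d j) + (\<Sum>j\<in>{Suc i..<N-1}. ?d j)"
    by (simp add: sum.union_disjoint)
  \<comment> \<open>On each side of the diagonal, \<open>m\<close> is the distance to it minus
    1.\<close>
  also have "(\<Sum>j\<in>{0..<i}. ?d j) = (\<Sum>m<i. ?g m)"
    by (rule sum.reindex_bij_witness[of _ "\<lambda>m. i - Suc m" "\<lambda>j. i - Suc j"])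
      (auto simp: idist_def nat_diff_distrib Suc_diff_Suc)
  also have "(\<Sum>j\<in>{Suc i..<N-1}. ?d j) = (\<Sum>m<N - 2 - i. ?g m)"
    by (rule sum.reindex_bij_witness[of _ "\<lambda>m. Suc (i + m)" "\<lambda>j. j - Suc i"])
      (auto simp: idist_def nat_diff_distrib Suc_diff_Suc)
  finally have "(\<Sum>j\<in>{0..<N-1} - {i}. ?d j) = 2 * G \<gamma> 0 - G \<gamma> i - G \<gamma> (N - 2 - i)"
    by (simp add: sum_lessThan_telescope')
  also have "\<dots> \<le> 2 * G \<gamma> 0"
    using G_nonneg[OF \<gamma>(2), of i] G_nonneg[OF \<gamma>(2), of "N - 2 - i"] by simp
  finally have "mu \<gamma> T N * (\<Sum>j\<in>{0..<N-1} - {i}. ?d j) \<le> mu \<gamma> T N * (2 * G \<gamma> 0)"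
    using mu by (intro mult_left_mono) auto
  \<comment> \<open>The summand 1, from the zeroth-order term of the scheme, makes the dominance
    strict.\<close>
  moreover have "\<bar>stiffness_mat \<gamma> T N $$ (i, i)\<bar> = mu \<gamma> T N * (2 * G \<gamma> 0) + 1"
    using i mu G_nonneg[OF \<gamma>(2), of 0] by (simp add: stiffness_mat_def stiffness_entry_def)
  ultimately show ?thesis by (simp add: d sum_distrib_left)
qed

theorem theorem2p3:
  fixes \<gamma> T :: real and N :: nat
  assumes "0 < \<gamma>" and "\<gamma> < 1" and "T > 0" and "N \<ge> 2"
  shows "(\<forall>f\<in>carrier_vec (N - 1). \<exists>!u. u \<in> carrier_vec (N - 1) \<and> solves_scheme \<gamma> T N f u)
       \<and> (\<exists>!A. is_stiffness_matrix \<gamma> T N A)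
       \<and> (\<forall>A. is_stiffness_matrix \<gamma> T N A \<longrightarrow> symmetric_mat A \<and> toeplitz_mat A)"
proof (intro conjI ballI)
  fix f :: "real vec" assume f: "f \<in> carrier_vec (N - 1)"
  have "\<exists>!u. u \<in> carrier_vec (N - 1) \<and> stiffness_mat \<gamma> T N *\<^sub>v u = f"
  proof (rule unique_solution_if_trivial_kernel[OF stiffness_mat_carrier _ f])
    fix v :: "real vec"
    assume "v \<in> carrier_vec (N - 1)" "stiffness_mat \<gamma> T N *\<^sub>v v = 0\<^sub>v (N - 1)"
    with assms show "v = 0\<^sub>v (N - 1)"
      by - (rule strictly_diag_dominant_kernel[OF stiffness_mat_carrier stiffness_mat_diag_dominant],
          simp_all)
  qed
  \<comment> \<open>Stated as an equality of predicates so that it can be substituted under the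
    unique existence quantifier.\<close>
  also have "(\<lambda>u. u \<in> carrier_vec (N - 1) \<and> stiffness_mat \<gamma> T N *\<^sub>v u = f)
      = (\<lambda>u. u \<in> carrier_vec (N - 1) \<and> solves_scheme \<gamma> T N f u)"
    using is_stiffness_matrix_stiffness_mat[of \<gamma> T N] f
    unfolding is_stiffness_matrix_def by blast
  finally show "\<exists>!u. u \<in> carrier_vec (N - 1) \<and> solves_scheme \<gamma> T N f u" .
qed (auto simp: is_stiffness_matrix_iff symmetric_stiffness_mat toeplitz_stiffness_mat)

end
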